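(* Let $A\in\{A_1,A_2\}$. For the existence and uniqueness of a solution $\varphi\in H$ of the operator equation $\varphi=A\varphi$ satisfying the boundary condition $\lim_{u\to+\infty}\varphi(u)=1$, it is necessary and sufficient that there exist functions $\varphi_*,\varphi^*\in H$ such that (a) $\varphi_*(u)\le\varphi^*(u)$, $A\varphi^*(u)\le\varphi^*(u)$ and $A\varphi_*(u)\ge\varphi_*(u)$ for all $u\ge0$; (b) $\lim_{u\to+\infty}\varphi_*(u)=\lim_{u\to+\infty}\varphi^*(u)=1$.
   Context: $H$ is the set of nondecreasing functions $\varphi:[0,+\infty)\to[0,1]$. $\alpha_c,\alpha_p>0$ are the intensities of claims and premiums. $F$ is the distribution function of the claims, $F(z)=0$ for $z\le0$, and $G$ is the distribution function of the premiums (nonnegative random variables). $c(\cdot)\ge0$ is a piecewise continuous function (intensity of deterministic payments as a function of current capital) and $U(u,t)$ is the solution of the Cauchy problem $dU/dt=c(U)$, $U(u,0)=u$; it is nondecreasing in $u$. $K_p,K_c$ are the distribution functions of the waiting times $\tau_p,\tau_c$ until a premium and a claim, respectively; they have no common discontinuity points and $K_p(t)<1$, $K_c(t)<1$ for all $t\ge0$. For $u\ge0$, $$A_1\varphi(u)=\frac{\alpha_c}{\alpha_c+\alpha_p}\int_0^u\varphi(u-z)\,dF(z)+\frac{\alpha_p}{\alpha_c+\alpha_p}\int_0^{+\infty}\varphi(u+z)\,dG(z),$$ $$A_2\varphi(u)=\int_0^\infty\!\int_0^{U(u,t)}\varphi(U(u,t)-z)\,dF(z)(1-K_p(t))\,dK_c(t)+\int_0^\infty\!\int_0^{+\infty}\varphi(U(u,t)+z)\,dG(z)(1-K_c(t))\,dK_p(t).$$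 Integrals are understood in the Lebesgue–Stieltjes sense, with $\int_0^u dF(z)=F(u)$ and $\int_0^{+\infty}dG(z)=1$.
   Formalization: For A = A_2 it is additionally assumed that G(0) < 1, i.e. the premiums are not almost surely zero; without this, uniqueness can fail (e.g. premiums zero, claims equal to 1 and c(x) = 2−x on [0,2], c(x) = 10 for x > 2, with waiting time for claims at least 1). *)

theory Defs
  imports "HOL-Probability.Probability"
begin

text \<open>Elements of \<open>H\<close> are functions with domain \<open>[0, \<infinity>)\<close>: they are taken to be
  extensional (\<open>undefined\<close> on the negative reals), so that equality and uniqueness in \<open>H\<close>
  concern the values on \<open>[0, \<infinity>)\<close> only.\<close>

definition H :: "(real \<Rightarrow> real) set" where
  "H = {\<phi> \<in> {0..} \<rightarrow>\<^sub>E {0..1}. mono_on {0..} \<phi>}"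

definition distribution_function :: "(real \<Rightarrow> real) \<Rightarrow> bool" where
  "distribution_function F \<longleftrightarrow>
     mono F \<and> (\<forall>x. continuous (at_right x) F) \<and>
     (F \<longlongrightarrow> 0) at_bot \<and> (F \<longlongrightarrow> 1) at_top"

definition piecewise_continuous :: "(real \<Rightarrow> real) \<Rightarrow> bool" where
  "piecewise_continuous c \<longleftrightarrow>
     (\<forall>b\<ge>0. \<exists>S. finite S \<and> continuous_on ({0..b} - S) c) \<and>
     (\<forall>x\<ge>0. \<exists>l. (c \<longlongrightarrow> l) (at_right x)) \<and>
     (\<forall>x>0. \<exists>l. (c \<longlongrightarrow> l) (at_left x))"

text \<open>A solution \<open>y\<close> of \<open>dy/dt = c(y)\<close>, \<open>y(0) = u\<close> on \<open>[0, \<infinity>)\<close> for a piecewise continuous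
  \<open>c\<close> on \<open>[0, \<infinity>)\<close>: since \<open>c\<close> may jump, \<open>y\<close> may have corners, so the equation is required
  outside a set of times that is finite on every bounded interval, and \<open>y\<close> is continuous.\<close>

definition cauchy_solution :: "(real \<Rightarrow> real) \<Rightarrow> real \<Rightarrow> (real \<Rightarrow> real) \<Rightarrow> bool" where
  "cauchy_solution c u y \<longleftrightarrow>
     y 0 = u \<and> (\<forall>t\<ge>0. 0 \<le> y t) \<and> continuous_on {0..} y \<and>
     (\<forall>T\<ge>0. \<exists>S. finite S \<and>
        (\<forall>t\<in>{0..T} - S. (y has_real_derivative c (y t)) (at t within {0..})))"

text \<open>The endpoints belong to the ranges of integration; an atom of \<open>G\<close>, \<open>K\<^sub>p\<close> or \<open>K\<^sub>c\<close> at \<open>0\<close>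
  is therefore counted. For a distribution function \<open>F\<close> vanishing on \<open>(-\<infinity>, 0]\<close> this gives
  \<open>\<integral>\<^sub>0\<^sup>u dF(z) = F(u)\<close>.\<close>

definition A1 ::
  "real \<Rightarrow> real \<Rightarrow> (real \<Rightarrow> real) \<Rightarrow> (real \<Rightarrow> real) \<Rightarrow> (real \<Rightarrow> real) \<Rightarrow> real \<Rightarrow> real" where
  "A1 \<alpha>c \<alpha>p F G \<phi> = (\<lambda>u\<in>{0..}.
     \<alpha>c / (\<alpha>c + \<alpha>p) * (LINT z:{0..u}|interval_measure F. \<phi> (u - z)) +
     \<alpha>p / (\<alpha>c + \<alpha>p) * (LINT z:{0..}|interval_measure G. \<phi> (u + z)))"

definition A2 ::
  "(real \<Rightarrow> real) \<Rightarrow> (real \<Rightarrow> real) \<Rightarrow> (real \<Rightarrow> real) \<Rightarrow> (real \<Rightarrow> real) \<Rightarrow>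
   (real \<Rightarrow> real \<Rightarrow> real) \<Rightarrow> (real \<Rightarrow> real) \<Rightarrow> real \<Rightarrow> real" where
  "A2 F G Kp Kc U \<phi> = (\<lambda>u\<in>{0..}.
     (LINT t:{0..}|interval_measure Kc.
        (LINT z:{0..U u t}|interval_measure F. \<phi> (U u t - z)) * (1 - Kp t)) +
     (LINT t:{0..}|interval_measure Kp.
        (LINT z:{0..}|interval_measure G. \<phi> (U u t + z)) * (1 - Kc t)))"

end

theory Submission
  imports Defs
begin

text \<open>Both operators have the form \<open>A \<phi> u = E \<phi>(X\<^sub>u)\<close>, where \<open>X\<^sub>u\<close> is the capital after the next
  claim or premium, \<open>X\<^sub>u\<close> is monotone in \<open>u\<close>, and \<open>\<phi>\<close> is extended by \<open>0\<close> to the negative reals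
  (ruin). Hence \<open>A\<close> is monotone on \<open>H\<close>, and the pointwise infimum of all supersolutions above
  \<open>\<phi>\<^sub>*\<close> is a fixed point (Knaster-Tarski).

  For uniqueness, the difference \<open>d\<close> of two solutions satisfies \<open>d(u) = E d(X\<^sub>u)\<close>, vanishes on
  the negative reals and tends to \<open>0\<close> at \<open>+\<infinity>\<close>. There is an event of positive probability \<open>q\<close> on which \<open>X\<^sub>u\<close>
  differs from \<open>u\<close> by at least \<open>\<epsilon>\<close> in a fixed direction: downwards for \<open>A\<^sub>1\<close> (a claim),
  upwards for \<open>A\<^sub>2\<close> (a premium, as \<open>U(u,t) \<ge> u\<close>). From any point, a bounded number \<open>N\<close> of such moves
  reaches the region where \<open>\<bar>d\<bar> \<le> sup \<bar>d\<bar> / 2\<close>, so \<open>sup \<bar>d\<bar> \<le> (1 - q\<^sup>N / 2) sup \<bar>d\<bar>\<close>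
  and \<open>d = 0\<close>.\<close>

section \<open>Functions in \<open>H\<close> and their extension by zero\<close>

definition zero_ext :: "(real \<Rightarrow> real) \<Rightarrow> real \<Rightarrow> real" where
  "zero_ext \<phi> x = (if x < 0 then 0 else \<phi> x)"

lemma H_range: "\<phi> \<in> H \<Longrightarrow> 0 \<le> u \<Longrightarrow> 0 \<le> \<phi> u \<and> \<phi> u \<le> 1"
  unfolding H_def by (fastforce simp: PiE_iff)

lemma H_mono: "\<phi> \<in> H \<Longrightarrow> 0 \<le> u \<Longrightarrow> u \<le> v \<Longrightarrow> \<phi> u \<le> \<phi> v"
  unfolding H_def by (simp add: mono_on_def)

lemma H_extensional: "\<phi> \<in> H \<Longrightarrow> \<phi> \<in> extensional {0..}"
  unfolding H_def by (auto simp: PiE_iff)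

lemma restrict_in_H:
  assumes "\<And>u. 0 \<le> u \<Longrightarrow> 0 \<le> f u \<and> f u \<le> 1"
    and "\<And>u v. 0 \<le> u \<Longrightarrow> u \<le> v \<Longrightarrow> f u \<le> f v"
  shows "restrict f {0..} \<in> H"
  unfolding H_def using assms by (auto intro!: mono_onI)

lemma zero_ext_nonneg [simp]: "0 \<le> x \<Longrightarrow> zero_ext \<phi> x = \<phi> x"
  and zero_ext_neg [simp]: "x < 0 \<Longrightarrow> zero_ext \<phi> x = 0"
  by (auto simp: zero_ext_def)

lemma zero_ext_range: "\<phi> \<in> H \<Longrightarrow> 0 \<le> zero_ext \<phi> x \<and> zero_ext \<phi> x \<le> 1"
  using H_range by (auto simp: zero_ext_def)

lemma mono_zero_ext: "\<phi> \<in> H \<Longrightarrow> mono (zero_ext \<phi>)"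
  using H_range H_mono by (auto simp: zero_ext_def mono_def)

lemma borel_measurable_zero_ext: "\<phi> \<in> H \<Longrightarrow> zero_ext \<phi> \<in> borel_measurable borel"
  using mono_zero_ext by (rule borel_measurable_mono)

text \<open>A single probability space drives every starting point, so monotonicity in
  \<open>u\<close> can be demanded outcome by outcome. The event \<open>E\<close> and the step
  \<open>\<epsilon>\<close> do not depend on \<open>u\<close>; this is what makes the contraction in
  the uniqueness argument uniform.\<close>

locale random_step = prob_space M for M :: "'a measure" +
  fixes X :: "real \<Rightarrow> 'a \<Rightarrow> real" and A :: "(real \<Rightarrow> real) \<Rightarrow> real \<Rightarrow> real"
    and E :: "'a set" and \<epsilon> :: real
  assumes X_measurable: "\<And>u. 0 \<le> u \<Longrightarrow> X u \<in> borel_measurable M"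
    and X_mono: "\<And>u v \<omega>. 0 \<le> u \<Longrightarrow> u \<le> v \<Longrightarrow> X u \<omega> \<le> X v \<omega>"
    and A_eq: "\<And>\<phi>. \<phi> \<in> H \<Longrightarrow> A \<phi> = (\<lambda>u\<in>{0..}. expectation (\<lambda>\<omega>. zero_ext \<phi> (X u \<omega>)))"
    and E_event: "E \<in> events" and E_pos: "0 < prob E" and \<epsilon>_pos: "0 < \<epsilon>"
    and drift: "(\<forall>u\<ge>0. \<forall>\<omega>\<in>E. X u \<omega> \<le> u - \<epsilon>) \<or> (\<forall>u\<ge>0. \<forall>\<omega>\<in>E. u + \<epsilon> \<le> X u \<omega>)"
begin

section \<open>Monotonicity of \<open>A\<close> on \<open>H\<close> and existence of a fixed
  point\<close>

lemma integrable_zero_ext: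
  assumes "\<phi> \<in> H" "0 \<le> u"
  shows "integrable M (\<lambda>\<omega>. zero_ext \<phi> (X u \<omega>))"
proof (rule integrable_const_bound[where B = 1])
  show "AE \<omega> in M. norm (zero_ext \<phi> (X u \<omega>)) \<le> 1"
    by (simp add: zero_ext_range[OF assms(1)])
  show "(\<lambda>\<omega>. zero_ext \<phi> (X u \<omega>)) \<in> borel_measurable M"
    using measurable_compose[OF X_measurable[OF assms(2)] borel_measurable_zero_ext[OF assms(1)]] .
qed

lemma A_apply: "\<phi> \<in> H \<Longrightarrow> 0 \<le> u \<Longrightarrow> A \<phi> u = expectation (\<lambda>\<omega>. zero_ext \<phi> (X u \<omega>))"
  by (simp add: A_eq)

lemma A_in_H:
  assumes "\<phi> \<in> H" shows "A \<phi> \<in> H"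
  unfolding A_eq[OF assms]
proof (rule restrict_in_H, goal_cases)
  case (1 u)
  have "0 \<le> expectation (\<lambda>\<omega>. zero_ext \<phi> (X u \<omega>))"
    using zero_ext_range[OF assms] by (simp add: integral_nonneg)
  moreover have "expectation (\<lambda>\<omega>. zero_ext \<phi> (X u \<omega>)) \<le> 1"
    using integrable_zero_ext[OF assms 1] by (rule integral_le_const) (simp add: zero_ext_range[OF assms])
  ultimately show ?case ..
next
  case (2 u v)
  show ?case
  proof (rule integral_mono)
    show "zero_ext \<phi> (X u \<omega>) \<le> zero_ext \<phi> (X v \<omega>)" for \<omega>
      using mono_zero_ext[OF assms] X_mono[OF 2] by (rule monoD)
  qed (use 2 in \<open>auto intro: integrable_zero_ext assms\<close>)
qed

lemma A_mono:
  assumes "\<phi> \<in> H" "\<psi> \<in> H" "\<And>u. 0 \<le> u \<Longrightarrow> \<phi> u \<le> \<psi> u" "0 \<le> u"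
  shows "A \<phi> u \<le> A \<psi> u"
proof -
  have "zero_ext \<phi> x \<le> zero_ext \<psi> x" for x
    using assms(3)[of x] by (cases "x < 0") auto
  then show ?thesis
    unfolding A_apply[OF assms(1,4)] A_apply[OF assms(2,4)]
    by (intro integral_mono integrable_zero_ext assms)
qed

text \<open>Only supersolutions lying above \<open>l\<close> enter the infimum, and \<open>h\<close>
  shows that there is one. Keeping the fixed point above \<open>l\<close> is what later forces its
  limit at infinity to be 1.\<close>

lemma fixpoint_above_subsolution:
  assumes l: "l \<in> H" "\<And>u. 0 \<le> u \<Longrightarrow> l u \<le> A l u"
    and h: "h \<in> H" "\<And>u. 0 \<le> u \<Longrightarrow> A h u \<le> h u" "\<And>u. 0 \<le> u \<Longrightarrow> l u \<le> h u"
  shows "\<exists>\<phi>\<in>H. \<phi> = A \<phi> \<and> (\<forall>u\<ge>0. l u \<le> \<phi> u)"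
proof -
  define \<Sigma> where "\<Sigma> = {\<psi> \<in> H. \<forall>u\<ge>0. A \<psi> u \<le> \<psi> u \<and> l u \<le> \<psi> u}"
  define \<phi> where "\<phi> = (\<lambda>u\<in>{0..}. INF \<psi>\<in>\<Sigma>. \<psi> u)"
  have \<Sigma>_H: "\<psi> \<in> H" if "\<psi> \<in> \<Sigma>" for \<psi> using that by (simp add: \<Sigma>_def)
  have h_\<Sigma>: "h \<in> \<Sigma>" using h by (simp add: \<Sigma>_def)
  have bdd: "bdd_below ((\<lambda>\<psi>. \<psi> u) ` \<Sigma>)" if "0 \<le> u" for u
    using H_range[OF \<Sigma>_H that] by (auto intro!: bdd_belowI2[where m = 0])
  have lower: "\<phi> u \<le> \<psi> u" if "0 \<le> u" "\<psi> \<in> \<Sigma>" for u \<psi>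
    using that bdd by (auto simp: \<phi>_def intro!: cINF_lower)
  have greatest: "x \<le> \<phi> u" if "0 \<le> u" "\<And>\<psi>. \<psi> \<in> \<Sigma> \<Longrightarrow> x \<le> \<psi> u" for u x
    using that h_\<Sigma> by (auto simp: \<phi>_def intro!: cINF_greatest)
  have \<phi>_H: "\<phi> \<in> H"
  proof -
    have "restrict \<phi> {0..} \<in> H"
    proof (rule restrict_in_H, goal_cases)
      case (1 u)
      then show ?case
        using greatest[of u 0] lower[OF _ h_\<Sigma>, of u] H_range[OF h(1), of u] H_range \<Sigma>_H by force
    next
      case (2 u v)
      have "\<phi> u \<le> \<psi> v" if "\<psi> \<in> \<Sigma>" for \<psi>
        using lower[OF 2(1) that] H_mono[OF \<Sigma>_H[OF that] 2] by linarith
      then show ?case using 2 by (intro greatest) auto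
    qed
    then show ?thesis by (simp add: \<phi>_def)
  qed
  have l_\<phi>: "l u \<le> \<phi> u" if "0 \<le> u" for u
    using that by (intro greatest) (auto simp: \<Sigma>_def)
  have A_\<phi>: "A \<phi> u \<le> \<phi> u" if u: "0 \<le> u" for u
  proof (rule greatest[OF u])
    fix \<psi> assume \<psi>: "\<psi> \<in> \<Sigma>"
    have "A \<phi> u \<le> A \<psi> u" using \<phi>_H \<Sigma>_H[OF \<psi>] lower[OF _ \<psi>] u by (rule A_mono)
    also have "\<dots> \<le> \<psi> u" using \<psi> u by (simp add: \<Sigma>_def)
    finally show "A \<phi> u \<le> \<psi> u" .
  qed
  have "l u \<le> A \<phi> u" if "0 \<le> u" for u
    using l(2)[OF that] A_mono[OF l(1) \<phi>_H l_\<phi> that] by linarith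
  \<comment> \<open>Applying the monotone \<open>A\<close> to \<open>A \<phi> \<le> \<phi>\<close>
    shows that \<open>A \<phi>\<close> is again a supersolution, so it competes in the infimum and
    \<open>\<phi> \<le> A \<phi>\<close>.\<close>
  then have "A \<phi> \<in> \<Sigma>"
    using A_in_H[OF \<phi>_H] A_mono[OF A_in_H[OF \<phi>_H] \<phi>_H A_\<phi>] by (simp add: \<Sigma>_def)
  then have "\<phi> x = A \<phi> x" if "x \<in> {0..}" for x
    using lower[of x] A_\<phi>[of x] that by (simp add: order_antisym)
  then have "\<phi> = A \<phi>"
    by (rule extensionalityI[OF H_extensional[OF \<phi>_H] H_extensional[OF A_in_H[OF \<phi>_H]]])
  with \<phi>_H l_\<phi> show ?thesis by blast
qed

section \<open>Uniqueness: bounded harmonic functions with zero boundary values\<close>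

lemma harmonic_step_bound:
  fixes d :: "real \<Rightarrow> real"
  assumes d: "d \<in> borel_measurable borel" "\<And>x. \<bar>d x\<bar> \<le> B"
    and fix_d: "d u = expectation (\<lambda>\<omega>. d (X u \<omega>))" and u: "0 \<le> u"
    and s: "\<And>\<omega>. \<omega> \<in> E \<Longrightarrow> \<bar>d (X u \<omega>)\<bar> \<le> s"
  shows "\<bar>d u\<bar> \<le> B - prob E * (B - s)"
proof -
  have m: "(\<lambda>\<omega>. d (X u \<omega>)) \<in> borel_measurable M"
    using measurable_compose[OF X_measurable[OF u] d(1)] .
  have int: "integrable M (\<lambda>\<omega>. d (X u \<omega>))"
    using d(2) m by (intro integrable_const_bound[where B = B]) auto
  have "\<bar>d u\<bar> \<le> expectation (\<lambda>\<omega>. \<bar>d (X u \<omega>)\<bar>)"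
    unfolding fix_d by (rule integral_abs_bound)
  \<comment> \<open>The majorant equals \<open>s\<close> on \<open>E\<close> and \<open>B\<close>
    elsewhere, so its mean involves \<open>E\<close> only through \<open>prob E\<close>.\<close>
  also have "\<dots> \<le> expectation (\<lambda>\<omega>. B - indicator E \<omega> * (B - s))"
  proof (rule integral_mono)
    show "integrable M (\<lambda>\<omega>. B - indicator E \<omega> * (B - s))"
      using E_event by (intro Bochner_Integration.integrable_diff integrable_mult_left) (auto simp: less_top[symmetric])
    show "\<bar>d (X u \<omega>)\<bar> \<le> B - indicator E \<omega> * (B - s)" for \<omega>
      using d(2) s by (cases "\<omega> \<in> E") auto
  qed (use int in auto)
  also have "\<dots> = B - prob E * (B - s)"
    using E_event by (subst Bochner_Integration.integral_diff) (auto simp: less_top[symmetric] prob_space)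
  finally show ?thesis .
qed

lemma harmonic_vanishes:
  fixes d :: "real \<Rightarrow> real"
  assumes d: "d \<in> borel_measurable borel" "\<And>x. \<bar>d x\<bar> \<le> C" "\<And>x. x < 0 \<Longrightarrow> d x = 0"
    and fix_d: "\<And>u. 0 \<le> u \<Longrightarrow> d u = expectation (\<lambda>\<omega>. d (X u \<omega>))"
    and lim: "(d \<longlongrightarrow> 0) at_top"
  shows "d x = 0"
proof -
  define B where "B = (SUP x. \<bar>d x\<bar>)"
  define q where "q = prob E"
  have bdd: "bdd_above (range (\<lambda>x. \<bar>d x\<bar>))" using d(2) by (auto intro!: bdd_aboveI2)
  have B: "\<bar>d x\<bar> \<le> B" for x unfolding B_def using bdd by (intro cSUP_upper) auto
  have q: "0 < q" "q \<le> 1" using E_pos by (auto simp: q_def)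
  have "B \<le> 0"
  proof (rule ccontr)
    assume "\<not> B \<le> 0"
    then have B_pos: "0 < B" by simp
    with lim have "eventually (\<lambda>x. \<bar>d x\<bar> < B / 2) at_top"
      by (auto simp: tendsto_iff dist_real_def dest: spec[where x = "B / 2"])
    then obtain L where L: "\<And>x. L \<le> x \<Longrightarrow> \<bar>d x\<bar> < B / 2"
      by (auto simp: eventually_at_top_linorder)
    obtain N where N: "L < real N * \<epsilon>" using reals_Archimedean3[OF \<epsilon>_pos] by blast
    \<comment> \<open>Both drift directions share this induction. \<open>S n\<close> collects points
      from which \<open>n\<close> moves in \<open>E\<close> suffice to reach the region
      \<open>x < 0\<close> or \<open>L \<le> x\<close>, where
      \<open>\<bar>d x\<bar> \<le> B / 2\<close>. Each move turns the gain \<open>q ^ n / 2\<close>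
      into \<open>q ^ Suc n / 2\<close>; points already in that region satisfy the bound for every
      \<open>n\<close>.\<close>
    have contract: "\<forall>x. \<bar>d x\<bar> \<le> B * (1 - q ^ N / 2)"
      if S0: "\<And>x. x \<in> S 0 \<Longrightarrow> x < 0 \<or> L \<le> x"
        and SS: "\<And>n x. x \<in> S (Suc n) \<Longrightarrow> 0 \<le> x \<Longrightarrow> x < L \<Longrightarrow> \<forall>\<omega>\<in>E. X x \<omega> \<in> S n"
        and SN: "S N = UNIV" for S :: "nat \<Rightarrow> real set"
    proof -
      have outside: "\<bar>d x\<bar> \<le> B * (1 - q ^ n / 2)" if "x < 0 \<or> L \<le> x" for x n
      proof -
        have "q ^ n \<le> 1" using q by (simp add: power_le_one)
        then have "B * (1 / 2) \<le> B * (1 - q ^ n / 2)" using B_pos by (intro mult_left_mono) auto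
        moreover have "\<bar>d x\<bar> \<le> B * (1 / 2)" using that L[of x] d(3)[of x] B_pos by auto
        ultimately show ?thesis by linarith
      qed
      have "\<bar>d x\<bar> \<le> B * (1 - q ^ n / 2)" if "x \<in> S n" for x n
        using that
      proof (induction n arbitrary: x)
        case 0
        then show ?case using outside[of x 0] S0 by simp
      next
        case (Suc n)
        show ?case
        proof (cases "x < 0 \<or> L \<le> x")
          case True then show ?thesis by (rule outside)
        next
          case False
          then have "\<bar>d x\<bar> \<le> B - q * (B - B * (1 - q ^ n / 2))"
            unfolding q_def
            using Suc SS[of x n] by (intro harmonic_step_bound d(1) B fix_d) (auto simp: q_def)
          then show ?thesis by (simp add: algebra_simps)
        qed
      qed
      then show ?thesis using SN by blast
    qed
    have "\<forall>x. \<bar>d x\<bar> \<le> B * (1 - q ^ N / 2)"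
      using drift
    proof
      assume down: "\<forall>u\<ge>0. \<forall>\<omega>\<in>E. X u \<omega> \<le> u - \<epsilon>"
      show ?thesis
      \<comment> \<open>Downward moves lower the threshold \<open>n * \<epsilon>\<close> one step at
        a time until ruin; at \<open>n = N\<close> it exceeds \<open>L\<close>, so every point is
        covered.\<close>
      proof (rule contract[of "\<lambda>n. {x. x < real n * \<epsilon> \<or> L \<le> x}"], goal_cases)
        case (2 n x)
        then show ?case using down by (fastforce simp: algebra_simps)
      qed (use N in auto)
    next
      assume up: "\<forall>u\<ge>0. \<forall>\<omega>\<in>E. u + \<epsilon> \<le> X u \<omega>"
      show ?thesis
      \<comment> \<open>Upward moves climb towards \<open>L\<close>; at \<open>n = N\<close> the
        threshold \<open>L - n * \<epsilon>\<close> is negative, so every point is covered.\<close>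
      proof (rule contract[of "\<lambda>n. {x. x < 0 \<or> L - real n * \<epsilon> \<le> x}"], goal_cases)
        case (2 n x)
        then show ?case using up by (fastforce simp: algebra_simps)
      qed (use N in auto)
    qed
    \<comment> \<open>The bound is uniform in \<open>x\<close>, hence passes to the supremum
      \<open>B\<close>, which would have to be smaller than itself.\<close>
    then have "B \<le> B * (1 - q ^ N / 2)" unfolding B_def by (intro cSUP_least) auto
    moreover have "0 < B * q ^ N" using B_pos q by simp
    ultimately show False by (simp add: algebra_simps)
  qed
  then show ?thesis using B[of x] by simp
qed

lemma fixpoint_unique:
  assumes H: "\<phi> \<in> H" "\<psi> \<in> H" and fp: "\<phi> = A \<phi>" "\<psi> = A \<psi>"
    and lim: "(\<phi> \<longlongrightarrow> 1) at_top" "(\<psi> \<longlongrightarrow> 1) at_top"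
  shows "\<phi> = \<psi>"
proof -
  \<comment> \<open>Subtracting the zero extensions gives boundary value 0 at ruin, and the equal
    limits give 0 at infinity; the fixed-point equations make \<open>d\<close> harmonic on
    \<open>u \<ge> 0\<close>.\<close>
  define d where "d x = zero_ext \<phi> x - zero_ext \<psi> x" for x
  have d0: "d x = 0" for x
  proof (rule harmonic_vanishes[where d = d and C = 1])
    show "d \<in> borel_measurable borel"
      unfolding d_def using H by (intro borel_measurable_diff borel_measurable_zero_ext)
    show "\<bar>d x\<bar> \<le> 1" for x
      using zero_ext_range[OF H(1), of x] zero_ext_range[OF H(2), of x] by (auto simp: d_def)
    show "d x = 0" if "x < 0" for x using that by (simp add: d_def)
    show "d u = expectation (\<lambda>\<omega>. d (X u \<omega>))" if "0 \<le> u" for u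
      using that A_apply[OF H(1) that] A_apply[OF H(2) that] H integrable_zero_ext
      by (simp add: d_def fun_cong[OF fp(1), symmetric] fun_cong[OF fp(2), symmetric])
    have "((\<lambda>x. \<phi> x - \<psi> x) \<longlongrightarrow> 1 - 1) at_top" by (intro tendsto_diff lim)
    moreover have "eventually (\<lambda>x. \<phi> x - \<psi> x = d x) at_top"
      using eventually_ge_at_top[of 0] by eventually_elim (simp add: d_def)
    ultimately show "(d \<longlongrightarrow> 0) at_top" by (simp add: tendsto_cong)
  qed
  show ?thesis
    using H_extensional[OF H(1)] H_extensional[OF H(2)]
  proof (rule extensionalityI)
    show "\<phi> x = \<psi> x" if "x \<in> {0..}" for x
      using d0[of x] that by (simp add: d_def)
  qed
qed

text \<open>For necessity the solution itself serves as both bounds. For sufficiency the fixed point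
  is squeezed between the lower bound and 1, which yields the boundary condition.\<close>

theorem unique_fixpoint_iff:
  "(\<exists>!\<phi>. \<phi> \<in> H \<and> \<phi> = A \<phi> \<and> (\<phi> \<longlongrightarrow> 1) at_top) \<longleftrightarrow>
    (\<exists>\<phi>l\<in>H. \<exists>\<phi>u\<in>H.
       (\<forall>u\<ge>0. \<phi>l u \<le> \<phi>u u \<and> A \<phi>u u \<le> \<phi>u u \<and> A \<phi>l u \<ge> \<phi>l u) \<and>
       (\<phi>l \<longlongrightarrow> 1) at_top \<and> (\<phi>u \<longlongrightarrow> 1) at_top)" (is "?L \<longleftrightarrow> ?R")
proof
  assume ?L
  then obtain \<phi> where \<phi>: "\<phi> \<in> H" "\<phi> = A \<phi>" "(\<phi> \<longlongrightarrow> 1) at_top" by blast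
  have "A \<phi> u = \<phi> u" for u using fun_cong[OF \<phi>(2)] by (rule sym)
  then show ?R using \<phi>(1,3) by (intro bexI[of _ \<phi>]) auto
next
  assume ?R
  then obtain l h where lh: "l \<in> H" "h \<in> H"
    "\<And>u. 0 \<le> u \<Longrightarrow> l u \<le> h u \<and> A h u \<le> h u \<and> l u \<le> A l u" "(l \<longlongrightarrow> 1) at_top"
    by blast
  then obtain \<phi> where \<phi>: "\<phi> \<in> H" "\<phi> = A \<phi>" "\<And>u. 0 \<le> u \<Longrightarrow> l u \<le> \<phi> u"
    using fixpoint_above_subsolution[of l h] by blast
  have "(\<phi> \<longlongrightarrow> 1) at_top"
  proof (rule tendsto_sandwich[OF _ _ lh(4) tendsto_const])
    show "eventually (\<lambda>u. l u \<le> \<phi> u) at_top"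
      using eventually_ge_at_top[of "0::real"] by eventually_elim (rule \<phi>(3))
    show "eventually (\<lambda>u. \<phi> u \<le> 1) at_top"
      using eventually_ge_at_top[of "0::real"] by eventually_elim (use H_range[OF \<phi>(1)] in blast)
  qed
  with \<phi>(1,2) show ?L by (intro ex1I[of _ \<phi>] conjI) (assumption+, elim conjE, rule fixpoint_unique)
qed

end

section \<open>Distribution functions and the deterministic flow\<close>

lemma distribution_function_measure:
  assumes "distribution_function F"
  shows real_distribution_of_distribution_function: "real_distribution (interval_measure F)"
    and measure_interval_measure_greaterThan: "measure (interval_measure F) {x<..} = 1 - F x"
proof -
  have F: "\<And>x y. x \<le> y \<Longrightarrow> F x \<le> F y" "\<And>a. continuous (at_right a) F"
    "(F \<longlongrightarrow> 0) at_bot" "(F \<longlongrightarrow> 1) at_top"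
    using assms by (auto simp: distribution_function_def dest: monoD)
  show *: "real_distribution (interval_measure F)"
    using F by (rule real_distribution_interval_measure)
  interpret real_distribution "interval_measure F" by fact
  have "measure (interval_measure F) (UNIV - {..x}) = 1 - F x"
    using prob_compl[of "{..x}"] measure_interval_measure_Iic[OF F(1-3)] by simp
  moreover have "UNIV - {..x} = {x<..}" by auto
  ultimately show "measure (interval_measure F) {x<..} = 1 - F x" by simp
qed

text \<open>The increment of \<open>y\<close> is the integral of \<open>c (y r) \<ge> 0\<close>, by
  the fundamental theorem of calculus with a finite exceptional set. With \<open>s = 0\<close> this
  gives \<open>u \<le> U u t\<close>, so that payments never reduce the capital.\<close>

lemma cauchy_solution_mono:
  assumes c: "\<And>x. 0 \<le> x \<Longrightarrow> 0 \<le> c x" and y: "cauchy_solution c u y" and st: "0 \<le> s" "s \<le> t"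
  shows "y s \<le> y t"
proof -
  have y_nonneg: "\<And>r. 0 \<le> r \<Longrightarrow> 0 \<le> y r" and cont: "continuous_on {0..} y"
    using y by (auto simp: cauchy_solution_def)
  obtain S where S: "finite S"
    "\<And>r. r \<in> {0..t} - S \<Longrightarrow> (y has_real_derivative c (y r)) (at r within {0..})"
    using y st unfolding cauchy_solution_def by (meson order_trans)
  have "((\<lambda>r. c (y r)) has_integral (y t - y s)) {s..t}"
  proof (rule fundamental_theorem_of_calculus_interior_strong[OF S(1) st(2)])
    fix r assume r: "r \<in> {s<..<t} - S"
    then have "(y has_real_derivative c (y r)) (at r within {0..})" using S(2) st by auto
    moreover have "at r within {0..} = at r" using r st by (intro at_within_interior) auto
    ultimately show "(y has_vector_derivative c (y r)) (at r)"
      by (simp add: has_real_derivative_iff_has_vector_derivative)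
  next
    show "continuous_on {s..t} y" using cont by (rule continuous_on_subset) (use st in auto)
  qed
  then have "0 \<le> y t - y s" by (rule has_integral_nonneg) (use c y_nonneg st in auto)
  then show ?thesis by simp
qed

text \<open>Right continuity carries the strict inequality from 0 to some positive point. The
  resulting \<open>\<epsilon>\<close> is the step size of the drift: a jump exceeds it with
  probability \<open>1 - F \<epsilon> > 0\<close>.\<close>

lemma positive_with_positive_probability:
  assumes "distribution_function F" "F 0 < 1"
  obtains \<epsilon> where "0 < \<epsilon>" "F \<epsilon> < 1"
proof -
  have "(F \<longlongrightarrow> F 0) (at_right 0)"
    using assms(1) by (simp add: distribution_function_def continuous_within)
  then have "eventually (\<lambda>x. F x < 1) (at_right 0)"
    using assms(2) by (rule order_tendstoD)
  then obtain b where "0 < b" "\<And>x. 0 < x \<Longrightarrow> x < b \<Longrightarrow> F x < 1"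
    by (auto simp: eventually_at_right_field)
  then show ?thesis by (intro that[of "b / 2"]) auto
qed

section \<open>Realising \<open>A1\<close> and \<open>A2\<close> as random steps\<close>

lemma set_integral_claim:
  "(LINT z:{0..x}|N. \<phi> (x - z)) = (LINT z|N. indicator {0..} z * zero_ext \<phi> (x - z))"
  unfolding set_lebesgue_integral_def
  by (rule Bochner_Integration.integral_cong) (auto simp: indicator_def)

lemma set_integral_premium:
  "0 \<le> x \<Longrightarrow> (LINT z:{0..}|N. \<phi> (x + z)) = (LINT z|N. indicator {0..} z * zero_ext \<phi> (x + z))"
  unfolding set_lebesgue_integral_def
  by (rule Bochner_Integration.integral_cong) (auto simp: indicator_def)

lemma (in finite_measure) measure_pair_measure_Times:
  assumes "finite_measure N" "C \<in> sets N" "D \<in> sets M"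
  shows "measure (N \<Otimes>\<^sub>M M) (C \<times> D) = measure N C * measure M D"
  using assms by (simp add: measure_def emeasure_pair_measure_Times enn2real_mult)

text \<open>The position after one step is the outcome of a coin toss between a claim and a premium;
  the value \<open>-1\<close> stands for ruin.\<close>

lemma random_step_A1:
  assumes \<alpha>: "\<alpha>c > 0" "\<alpha>p > 0"
    and F: "distribution_function F" "F 0 < 1" and G: "distribution_function G"
  shows "\<exists>E \<epsilon>. random_step
    (measure_pmf (bernoulli_pmf (\<alpha>c / (\<alpha>c + \<alpha>p))) \<Otimes>\<^sub>M (interval_measure F \<Otimes>\<^sub>M interval_measure G))
    (\<lambda>u (b, zc, zp). if b then if 0 \<le> zc then u - zc else -1 else if 0 \<le> zp then u + zp else -1)
    (A1 \<alpha>c \<alpha>p F G) E \<epsilon>"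
proof -
  define p where "p = \<alpha>c / (\<alpha>c + \<alpha>p)"
  have p: "0 < p" "p \<le> 1" "1 - p = \<alpha>p / (\<alpha>c + \<alpha>p)" using \<alpha> by (auto simp: p_def field_simps)
  let ?B = "measure_pmf (bernoulli_pmf p)" and ?F = "interval_measure F" and ?G = "interval_measure G"
  let ?M = "?B \<Otimes>\<^sub>M (?F \<Otimes>\<^sub>M ?G)"
  \<comment> \<open>Sending negative jumps to -1 reproduces the restriction of the integrals to
    \<open>z \<ge> 0\<close>. The choice of branch does not depend on \<open>u\<close>, so
    \<open>X\<close> is monotone in \<open>u\<close>.\<close>
  define X :: "real \<Rightarrow> bool \<times> real \<times> real \<Rightarrow> real" where
    "X = (\<lambda>u (b, zc, zp). if b then if 0 \<le> zc then u - zc else -1 else if 0 \<le> zp then u + zp else -1)"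
  interpret F: real_distribution ?F by (rule real_distribution_of_distribution_function[OF F(1)])
  interpret G: real_distribution ?G by (rule real_distribution_of_distribution_function[OF G])
  interpret FG: pair_prob_space ?F ?G ..
  interpret B: prob_space ?B by (rule measure_pmf.prob_space_axioms)
  interpret BFG: pair_prob_space ?B "?F \<Otimes>\<^sub>M ?G" ..
  obtain \<epsilon> where \<epsilon>: "0 < \<epsilon>" "F \<epsilon> < 1" using positive_with_positive_probability[OF F] .
  have [measurable]: "Measurable.pred ?B (\<lambda>b. b)" by simp
  have X[measurable]: "X u \<in> borel_measurable ?M" for u
    unfolding X_def by measurable
  \<comment> \<open>The coin selects a claim and the claim exceeds \<open>\<epsilon>\<close>, which
    has probability \<open>p * (1 - F \<epsilon>)\<close>. The downward direction is chosen because
    premiums may vanish almost surely here.\<close>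
  let ?E = "{True} \<times> ({\<epsilon><..} \<times> UNIV)"
  have "random_step ?M X (A1 \<alpha>c \<alpha>p F G) ?E \<epsilon>"
  proof (intro_locales, unfold_locales)
    show "X u \<omega> \<le> X v \<omega>" if "u \<le> v" for u v \<omega>
      using that by (auto simp: X_def split: prod.splits)
    show "?E \<in> sets ?M" by (intro pair_measureI) auto
    show "0 < measure ?M ?E"
      using p \<epsilon>(2) G.prob_space
      by (simp add: FG.measure_pair_measure_Times G.measure_pair_measure_Times
          measure_pmf.finite_measure_axioms F.finite_measure_axioms measure_pmf_single
          measure_interval_measure_greaterThan[OF F(1)])
    show "(\<forall>u\<ge>0. \<forall>\<omega>\<in>?E. X u \<omega> \<le> u - \<epsilon>) \<or> (\<forall>u\<ge>0. \<forall>\<omega>\<in>?E. u + \<epsilon> \<le> X u \<omega>)"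
      using \<epsilon>(1) by (auto simp: X_def)
    fix \<phi> assume \<phi>: "\<phi> \<in> H"
    note [measurable] = borel_measurable_zero_ext[OF \<phi>]
    have "A1 \<alpha>c \<alpha>p F G \<phi> u = (LINT \<omega>|?M. zero_ext \<phi> (X u \<omega>))" if u: "0 \<le> u" for u
    proof -
      have bound: "\<bar>zero_ext \<phi> x\<bar> \<le> 1" for x using zero_ext_range[OF \<phi>, of x] by auto
      have X_True: "zero_ext \<phi> (X u (True, z)) = indicator {0..} (fst z) * zero_ext \<phi> (u - fst z)"
        and X_False: "zero_ext \<phi> (X u (False, z)) = indicator {0..} (snd z) * zero_ext \<phi> (u + snd z)" for z
        by (auto simp: X_def indicator_def split: prod.splits)
      \<comment> \<open>Conditioning on the coin yields the weights \<open>p\<close> and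
        \<open>1 - p\<close>; in each case only one jump matters and the other integrates out to
        1.\<close>
      have "(LINT \<omega>|?M. zero_ext \<phi> (X u \<omega>)) =
        (LINT b|?B. LINT z|(?F \<Otimes>\<^sub>M ?G). zero_ext \<phi> (X u (b, z)))"
        using bound by (intro BFG.integral_fst'[symmetric] BFG.integrable_const_bound[where B = 1]) auto
      also have "\<dots> = p * (LINT z|(?F \<Otimes>\<^sub>M ?G). indicator {0..} (fst z) * zero_ext \<phi> (u - fst z))
          + (1 - p) * (LINT z|(?F \<Otimes>\<^sub>M ?G). indicator {0..} (snd z) * zero_ext \<phi> (u + snd z))"
        using p by (simp add: X_True X_False mult.commute)
      also have "(LINT z|(?F \<Otimes>\<^sub>M ?G). indicator {0..} (fst z) * zero_ext \<phi> (u - fst z)) =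
          (LINT z|?F. indicator {0..} z * zero_ext \<phi> (u - z))"
        using bound by (subst FG.integral_fst'[symmetric])
          (auto intro!: FG.integrable_const_bound[where B = 1] simp: abs_mult indicator_def G.prob_space[simplified])
      also have "(LINT z|(?F \<Otimes>\<^sub>M ?G). indicator {0..} (snd z) * zero_ext \<phi> (u + snd z)) =
          (LINT z|?G. indicator {0..} z * zero_ext \<phi> (u + z))"
        using bound by (subst FG.integral_fst'[symmetric])
          (auto intro!: FG.integrable_const_bound[where B = 1] simp: abs_mult indicator_def F.prob_space[simplified])
      finally show ?thesis
        using u by (simp add: A1_def set_integral_claim set_integral_premium p(3)) (simp add: p_def)
    qed
    then show "A1 \<alpha>c \<alpha>p F G \<phi> = (\<lambda>u\<in>{0..}. LINT \<omega>|?M. zero_ext \<phi> (X u \<omega>))"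
      by (auto simp: A1_def)
  qed (use \<epsilon> X in auto)
  then show ?thesis unfolding X_def p_def by blast
qed

text \<open>Condition on the first pair: given its time \<open>t\<close>, the independent second
  time is strictly later with probability \<open>1 - L t\<close>, and the second jump integrates
  out. Used twice, with the claim pair and then the premium pair in first place, it produces the two
  terms of \<open>A2\<close>.\<close>

lemma integral_first_event:
  fixes h :: "real \<times> real \<Rightarrow> real"
  assumes df: "distribution_function K" "distribution_function F"
    "distribution_function L" "distribution_function G"
    and h[measurable]: "h \<in> borel_measurable (borel \<Otimes>\<^sub>M borel)" and bound: "\<And>x. \<bar>h x\<bar> \<le> 1"
  shows "(LINT \<omega>|((interval_measure K \<Otimes>\<^sub>M interval_measure F) \<Otimes>\<^sub>M
            (interval_measure L \<Otimes>\<^sub>M interval_measure G)).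
           (if fst (fst \<omega>) < fst (snd \<omega>) then h (fst \<omega>) else 0)) =
    (LINT t|interval_measure K. (LINT z|interval_measure F. h (t, z)) * (1 - L t))"
proof -
  let ?K = "interval_measure K" and ?F = "interval_measure F"
    and ?L = "interval_measure L" and ?G = "interval_measure G"
  interpret K: real_distribution ?K by (rule real_distribution_of_distribution_function[OF df(1)])
  interpret F: real_distribution ?F by (rule real_distribution_of_distribution_function[OF df(2)])
  interpret L: real_distribution ?L by (rule real_distribution_of_distribution_function[OF df(3)])
  interpret G: real_distribution ?G by (rule real_distribution_of_distribution_function[OF df(4)])
  interpret KF: pair_prob_space ?K ?F ..
  interpret LG: pair_prob_space ?L ?G ..
  interpret KFLG: pair_prob_space "?K \<Otimes>\<^sub>M ?F" "?L \<Otimes>\<^sub>M ?G" ..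
  have tail: "1 - L t = measure ?L {t<..}" for t
    by (rule measure_interval_measure_greaterThan[OF df(3), symmetric])
  have [measurable]: "L \<in> borel_measurable borel"
    using df(3) by (intro borel_measurable_mono) (simp add: distribution_function_def)
  have [measurable]: "h \<in> borel_measurable (?K \<Otimes>\<^sub>M ?F)"
    using h by (simp cong: measurable_cong_sets sets_pair_measure_cong)
  have "(LINT \<omega>|((?K \<Otimes>\<^sub>M ?F) \<Otimes>\<^sub>M (?L \<Otimes>\<^sub>M ?G)).
           (if fst (fst \<omega>) < fst (snd \<omega>) then h (fst \<omega>) else 0)) =
    (LINT x|(?K \<Otimes>\<^sub>M ?F). LINT y|(?L \<Otimes>\<^sub>M ?G). (if fst x < fst y then h x else 0))"
    using bound
    by (subst KFLG.integral_fst'[symmetric]) (auto intro!: KFLG.integrable_const_bound[where B = 1] cong: if_cong)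
  also have "\<dots> = (LINT x|(?K \<Otimes>\<^sub>M ?F). h x * (1 - L (fst x)))"
  proof (rule Bochner_Integration.integral_cong)
    fix x :: "real \<times> real"
    have "(LINT y|(?L \<Otimes>\<^sub>M ?G). (if fst x < fst y then h x else 0)) =
      (LINT y|(?L \<Otimes>\<^sub>M ?G). h x * indicator ({fst x<..} \<times> UNIV) y)"
      by (rule Bochner_Integration.integral_cong) (auto simp: indicator_def)
    also have "\<dots> = h x * (1 - L (fst x))"
      using G.prob_space
      by (simp add: G.measure_pair_measure_Times L.finite_measure_axioms tail)
    finally show "(LINT y|(?L \<Otimes>\<^sub>M ?G). (if fst x < fst y then h x else 0)) = h x * (1 - L (fst x))" .
  qed simp
  also have "\<dots> = (LINT t|?K. LINT z|?F. h (t, z) * (1 - L t))"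
  proof (subst KF.integral_fst'[symmetric])
    show "integrable (?K \<Otimes>\<^sub>M ?F) (\<lambda>x. h x * (1 - L (fst x)))"
    proof (rule KF.integrable_const_bound[where B = 1])
      show "AE x in ?K \<Otimes>\<^sub>M ?F. norm (h x * (1 - L (fst x))) \<le> 1"
        using bound by (auto simp: abs_mult tail intro!: mult_le_one)
    qed measurable
  qed simp
  finally show ?thesis by simp
qed

text \<open>The position after one step is read off from two independent pairs of a waiting time and a
  jump size; the earlier one of the two events counts, and a tie is treated as ruin.\<close>

lemma random_step_A2:
  assumes F: "distribution_function F" and G: "distribution_function G" "G 0 < 1"
    and Kp: "distribution_function Kp" "Kp 0 < 1"
    and Kc: "distribution_function Kc" "\<And>t. t \<ge> 0 \<Longrightarrow> Kc t < 1"
    and U_cont: "\<And>u. 0 \<le> u \<Longrightarrow> continuous_on {0..} (U u)"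
    and U_ge: "\<And>u t. 0 \<le> u \<Longrightarrow> 0 \<le> t \<Longrightarrow> u \<le> U u t"
    and U_mono: "\<And>t. t \<ge> 0 \<Longrightarrow> mono_on {0..} (\<lambda>u. U u t)"
  shows "\<exists>X E \<epsilon>. random_step
    ((interval_measure Kc \<Otimes>\<^sub>M interval_measure F) \<Otimes>\<^sub>M (interval_measure Kp \<Otimes>\<^sub>M interval_measure G))
    X (A2 F G Kp Kc U) E \<epsilon>"
proof -
  let ?F = "interval_measure F" and ?G = "interval_measure G"
    and ?Kc = "interval_measure Kc" and ?Kp = "interval_measure Kp"
  let ?M = "(?Kc \<Otimes>\<^sub>M ?F) \<Otimes>\<^sub>M (?Kp \<Otimes>\<^sub>M ?G)"
  \<comment> \<open>Freezing the flow at its initial value for negative times makes it continuous,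
    hence measurable, on the whole line and keeps it at least \<open>u\<close> everywhere.\<close>
  define V where "V u t = U u (max 0 t)" for u t
  \<comment> \<open>The strict comparisons match the weights \<open>1 - Kp t\<close> and
    \<open>1 - Kc t\<close>. An earlier event with negative time or size leads to -1, as the
    integrals over \<open>{0..}\<close> require.\<close>
  define X :: "real \<Rightarrow> (real \<times> real) \<times> (real \<times> real) \<Rightarrow> real" where
    "X = (\<lambda>u ((tc, zc), (tp, zp)).
       if 0 \<le> tc \<and> 0 \<le> zc \<and> tc < tp then V u tc - zc
       else if 0 \<le> tp \<and> 0 \<le> zp \<and> tp < tc then V u tp + zp else -1)"
  interpret F: real_distribution ?F by (rule real_distribution_of_distribution_function[OF F])
  interpret G: real_distribution ?G by (rule real_distribution_of_distribution_function[OF G(1)])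
  interpret Kc: real_distribution ?Kc by (rule real_distribution_of_distribution_function[OF Kc(1)])
  interpret Kp: real_distribution ?Kp by (rule real_distribution_of_distribution_function[OF Kp(1)])
  interpret KcF: pair_prob_space ?Kc ?F ..
  interpret KpG: pair_prob_space ?Kp ?G ..
  interpret P: pair_prob_space "?Kc \<Otimes>\<^sub>M ?F" "?Kp \<Otimes>\<^sub>M ?G" ..
  interpret Q: pair_prob_space "?Kp \<Otimes>\<^sub>M ?G" "?Kc \<Otimes>\<^sub>M ?F" ..
  have V_meas: "V u \<in> borel_measurable borel" if "0 \<le> u" for u
  proof (rule borel_measurable_continuous_onI)
    show "continuous_on UNIV (V u)"
      unfolding V_def
      by (rule continuous_on_compose2[OF U_cont[OF that]]) (auto intro!: continuous_intros)
  qed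
  have V_ge: "u \<le> V u t" if "0 \<le> u" for u t using U_ge that by (simp add: V_def)
  have X_meas: "X u \<in> borel_measurable ?M" if "0 \<le> u" for u
  proof -
    note [measurable] = V_meas[OF that]
    show ?thesis unfolding X_def case_prod_beta by measurable
  qed
  obtain \<epsilon> where \<epsilon>: "0 < \<epsilon>" "G \<epsilon> < 1" using positive_with_positive_probability[OF G] .
  have Kp': "\<And>x y. x \<le> y \<Longrightarrow> Kp x \<le> Kp y" "\<And>a. continuous (at_right a) Kp" "(Kp \<longlongrightarrow> 1) at_top"
    using Kp(1) by (auto simp: distribution_function_def dest: monoD)
  \<comment> \<open>\<open>Kp\<close> tends to 1, which lies above \<open>Kp 0\<close>, so a premium
    arrives in \<open>{0<..T}\<close> with positive probability \<open>Kp T - Kp 0\<close>.\<close>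
  obtain T where T: "0 \<le> T" "Kp 0 < Kp T"
    using eventually_happens'[OF _ eventually_conj[OF eventually_ge_at_top[of 0]
        order_tendstoD(1)[OF Kp'(3) Kp(2)]]] by auto
  \<comment> \<open>The premium comes by time \<open>T\<close>, the claim only after
    \<open>T\<close>, and the premium exceeds \<open>\<epsilon>\<close>. The upward direction is
    chosen because growth along the flow could offset a claim.\<close>
  let ?E = "({T<..} \<times> UNIV) \<times> ({0<..T} \<times> {\<epsilon><..})"
  have "random_step ?M X (A2 F G Kp Kc U) ?E \<epsilon>"
  proof (intro_locales, unfold_locales)
    show "X u \<omega> \<le> X v \<omega>" if "0 \<le> u" "u \<le> v" for u v \<omega>
      using that U_mono by (auto simp: X_def V_def mono_on_def split: prod.splits)
    show "?E \<in> sets ?M" by (intro pair_measureI) auto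
    have "measure ?Kp {0<..T} = Kp T - Kp 0"
      using T(1) Kp'(1,2) by (rule measure_interval_measure_Ioc)
    then show "0 < measure ?M ?E"
      using T \<epsilon>(2) Kc(2)[OF T(1)] F.prob_space
      by (simp add: KpG.measure_pair_measure_Times G.measure_pair_measure_Times
          F.measure_pair_measure_Times KcF.finite_measure_axioms Kc.finite_measure_axioms
          Kp.finite_measure_axioms measure_interval_measure_greaterThan[OF G(1)]
          measure_interval_measure_greaterThan[OF Kc(1)])
    have "u + \<epsilon> \<le> X u \<omega>" if "0 \<le> u" "\<omega> \<in> ?E" for u \<omega>
      using that V_ge[OF that(1)] \<epsilon>(1) by (auto simp: X_def intro!: add_mono)
    then show "(\<forall>u\<ge>0. \<forall>\<omega>\<in>?E. X u \<omega> \<le> u - \<epsilon>) \<or> (\<forall>u\<ge>0. \<forall>\<omega>\<in>?E. u + \<epsilon> \<le> X u \<omega>)"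
      by blast
    fix \<phi> assume \<phi>: "\<phi> \<in> H"
    note [measurable] = borel_measurable_zero_ext[OF \<phi>]
    have bound: "\<bar>zero_ext \<phi> x\<bar> \<le> 1" for x using zero_ext_range[OF \<phi>, of x] by auto
    have "A2 F G Kp Kc U \<phi> u = (LINT \<omega>|?M. zero_ext \<phi> (X u \<omega>))" if u: "0 \<le> u" for u
    proof -
      note [measurable] = V_meas[OF u]
      define hc where "hc = (\<lambda>(t, z). indicator {0..} t * (indicator {0..} z * zero_ext \<phi> (V u t - z)))"
      define hp where "hp = (\<lambda>(t, z). indicator {0..} t * (indicator {0..} z * zero_ext \<phi> (V u t + z)))"
      have hc: "hc \<in> borel_measurable (borel \<Otimes>\<^sub>M borel)" "\<bar>hc x\<bar> \<le> 1" for x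
        unfolding hc_def using bound by (measurable, auto simp: indicator_def split: prod.splits)
      have hp: "hp \<in> borel_measurable (borel \<Otimes>\<^sub>M borel)" "\<bar>hp x\<bar> \<le> 1" for x
        unfolding hp_def using bound by (measurable, auto simp: indicator_def split: prod.splits)
      define Ic where "Ic \<omega> = (if fst (fst \<omega>) < fst (snd \<omega>) then hc (fst \<omega>) else 0)"
        for \<omega> :: "(real \<times> real) \<times> (real \<times> real)"
      \<comment> \<open>The premium pair is put first, so that \<open>integral_first_event\<close>
        applies after the factors of the product are swapped.\<close>
      define Ip where "Ip \<omega> = (if fst (fst \<omega>) < fst (snd \<omega>) then hp (fst \<omega>) else 0)"
        for \<omega> :: "(real \<times> real) \<times> (real \<times> real)"
      have [measurable]: "hc \<in> borel_measurable (?Kc \<Otimes>\<^sub>M ?F)" "hp \<in> borel_measurable (?Kp \<Otimes>\<^sub>M ?G)"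
        using hc(1) hp(1) by (simp_all cong: measurable_cong_sets sets_pair_measure_cong)
      have Ic: "integrable ?M Ic"
        using hc(2) by (intro P.integrable_const_bound[where B = 1]) (auto simp: Ic_def[abs_def])
      have Ip: "Ip \<in> borel_measurable ((?Kp \<Otimes>\<^sub>M ?G) \<Otimes>\<^sub>M (?Kc \<Otimes>\<^sub>M ?F))"
        unfolding Ip_def by measurable
      have Ip': "integrable ?M (\<lambda>(x, y). Ip (y, x))"
        using hp(2) by (intro P.integrable_const_bound[where B = 1]) (auto simp: Ip_def[abs_def])
      \<comment> \<open>The events \<open>tc < tp\<close> and \<open>tp < tc\<close> are disjoint
        and ties contribute 0, so the integrand is the sum of the two parts.\<close>
      have "(LINT \<omega>|?M. zero_ext \<phi> (X u \<omega>)) = (LINT \<omega>|?M. Ic \<omega> + (\<lambda>(x, y). Ip (y, x)) \<omega>)"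
        by (rule Bochner_Integration.integral_cong)
          (auto simp: X_def Ic_def Ip_def hc_def hp_def indicator_def)
      also have "\<dots> = (LINT \<omega>|?M. Ic \<omega>) + (LINT \<omega>|?M. (\<lambda>(x, y). Ip (y, x)) \<omega>)"
        using Ic Ip' by (rule Bochner_Integration.integral_add)
      also have "(LINT \<omega>|?M. (\<lambda>(x, y). Ip (y, x)) \<omega>) = (LINT \<omega>|((?Kp \<Otimes>\<^sub>M ?G) \<Otimes>\<^sub>M (?Kc \<Otimes>\<^sub>M ?F)). Ip \<omega>)"
        using Ip by (rule Q.integral_product_swap)
      also have "\<dots> = (LINT t|?Kp. (LINT z|?G. hp (t, z)) * (1 - Kc t))"
        unfolding Ip_def using Kp(1) G(1) Kc(1) F hp by (rule integral_first_event)
      also have "\<dots> = (LINT t:{0..}|?Kp. (LINT z:{0..}|?G. \<phi> (U u t + z)) * (1 - Kc t))"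
        unfolding set_lebesgue_integral_def[of ?Kp]
      proof (rule Bochner_Integration.integral_cong)
        show "(LINT z|?G. hp (t, z)) * (1 - Kc t) =
          indicator {0..} t *\<^sub>R ((LINT z:{0..}|?G. \<phi> (U u t + z)) * (1 - Kc t))" for t
          using U_ge[OF u, of t] u
          by (cases "0 \<le> t") (auto simp: hp_def set_integral_premium V_def)
      qed simp
      also have "(LINT \<omega>|?M. Ic \<omega>) = (LINT t|?Kc. (LINT z|?F. hc (t, z)) * (1 - Kp t))"
        unfolding Ic_def using Kc(1) F Kp(1) G(1) hc by (rule integral_first_event)
      also have "\<dots> = (LINT t:{0..}|?Kc. (LINT z:{0..U u t}|?F. \<phi> (U u t - z)) * (1 - Kp t))"
        unfolding set_lebesgue_integral_def[of ?Kc]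
      proof (rule Bochner_Integration.integral_cong)
        show "(LINT z|?F. hc (t, z)) * (1 - Kp t) =
          indicator {0..} t *\<^sub>R ((LINT z:{0..U u t}|?F. \<phi> (U u t - z)) * (1 - Kp t))" for t
          by (cases "0 \<le> t") (auto simp: hc_def set_integral_claim V_def)
      qed simp
      finally show ?thesis using u by (simp add: A2_def)
    qed
    then show "A2 F G Kp Kc U \<phi> = (\<lambda>u\<in>{0..}. LINT \<omega>|?M. zero_ext \<phi> (X u \<omega>))"
      by (auto simp: A2_def)
  qed (use \<epsilon> X_meas in auto)
  then show ?thesis by blast
qed

section \<open>Transfer of the equivalence to the two operators\<close>

theorem theorem6p3:
  fixes \<alpha>c \<alpha>p :: real
    and F G Kp Kc c :: "real \<Rightarrow> real"
    and U :: "real \<Rightarrow> real \<Rightarrow> real"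
    and A :: "(real \<Rightarrow> real) \<Rightarrow> real \<Rightarrow> real"
  assumes "\<alpha>c > 0" and "\<alpha>p > 0"
    and "distribution_function F" and "\<And>z. z \<le> 0 \<Longrightarrow> F z = 0"
    and "distribution_function G" and "\<And>z. z < 0 \<Longrightarrow> G z = 0"
    and "piecewise_continuous c" and "\<And>x. x \<ge> 0 \<Longrightarrow> c x \<ge> 0"
    and "\<And>u. u \<ge> 0 \<Longrightarrow> cauchy_solution c u (U u)"
    and "\<And>t. t \<ge> 0 \<Longrightarrow> mono_on {0..} (\<lambda>u. U u t)"
    and "distribution_function Kp" and "\<And>t. t < 0 \<Longrightarrow> Kp t = 0"
    and "distribution_function Kc" and "\<And>t. t < 0 \<Longrightarrow> Kc t = 0"
    and "\<And>t. isCont Kp t \<or> isCont Kc t"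
    and "\<And>t. t \<ge> 0 \<Longrightarrow> Kp t < 1" and "\<And>t. t \<ge> 0 \<Longrightarrow> Kc t < 1"
    (* for A2 the premiums must not vanish almost surely: the claim fails if G is
       concentrated at 0 *)
    and "A = A1 \<alpha>c \<alpha>p F G \<or> A = A2 F G Kp Kc U \<and> G 0 < 1"
  shows "(\<exists>!\<phi>. \<phi> \<in> H \<and> \<phi> = A \<phi> \<and> (\<phi> \<longlongrightarrow> 1) at_top) \<longleftrightarrow>
    (\<exists>\<phi>l\<in>H. \<exists>\<phi>u\<in>H.
       (\<forall>u\<ge>0. \<phi>l u \<le> \<phi>u u \<and> A \<phi>u u \<le> \<phi>u u \<and> A \<phi>l u \<ge> \<phi>l u) \<and>
       (\<phi>l \<longlongrightarrow> 1) at_top \<and> (\<phi>u \<longlongrightarrow> 1) at_top)"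
  using assms(18)
proof
  assume A: "A = A1 \<alpha>c \<alpha>p F G"
  have "F 0 < 1" using assms(4)[of 0] by simp
  with random_step_A1[OF assms(1-3) _ assms(5)] show ?thesis
    unfolding A using random_step.unique_fixpoint_iff by blast
next
  assume A: "A = A2 F G Kp Kc U \<and> G 0 < 1"
  have cont: "continuous_on {0..} (U u)" and start: "U u 0 = u" if "0 \<le> u" for u
    using assms(9)[OF that] by (auto simp: cauchy_solution_def)
  have "u \<le> U u t" if "0 \<le> u" "0 \<le> t" for u t
    using cauchy_solution_mono[OF assms(8) assms(9)[OF that(1)] order_refl that(2)] start[OF that(1)]
    by simp
  then obtain M :: "((real \<times> real) \<times> (real \<times> real)) measure" and X E \<epsilon>
    where "random_step M X A E \<epsilon>"
    using random_step_A2[OF assms(3,5) _ assms(11) assms(16)[OF order_refl] assms(13,17) cont _ assms(10)] A by blast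
  then show ?thesis by (rule random_step.unique_fixpoint_iff)
qed

end
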